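(* Let $\triangle$ be the operator on $n\times n$ difference-bound matrices over $\overline{\mathbb I}$ (with $\mathbb I\in\{\mathbb Z,\mathbb Q,\mathbb R\}$) defined by $(\vec m\triangle\vec n)_{ij}=\vec n_{ij}$ if $\vec m_{ij}=+\infty$, and $\vec m_{ij}$ otherwise. Then: 1. For all DBMs $\vec m,\vec n$, if $\mathcal D^0(\vec n)\subseteq\mathcal D^0(\vec m)$, then $\mathcal D^0(\vec n)\subseteq\mathcal D^0(\vec m\triangle\vec n)\subseteq\mathcal D^0(\vec m)$. 2. (Finite decreasing chain property) For every DBM $\vec m$ and every chain $(\vec n_i)_{i\in\mathbb N}$ of DBMs decreasing for $\trianglelefteq$, the chain defined by $\vec x_0=\vec m$, $\vec x_{i+1}=\vec x_i\triangle\vec n_i$ is decreasing and ultimately stationary.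
   Context: Let $\mathbb I$ be $\mathbb Z$, $\mathbb Q$ or $\mathbb R$, and $\overline{\mathbb I}=\mathbb I\cup\{+\infty\}$ with the usual extended order and addition. A difference-bound matrix (DBM) is an $n\times n$ matrix $\vec m$ with entries in $\overline{\mathbb I}$. Define $\mathcal D(\vec m)=\{(x_1,\dots,x_n)\in\mathbb I^n\;|\;\forall i,j,\ x_j-x_i\leq\vec m_{ij}\}$ and the $\mathcal V^0$-domain $\mathcal D^0(\vec m)=\{(x_2,\dots,x_n)\in\mathbb I^{n-1}\;|\;(0,x_2,\dots,x_n)\in\mathcal D(\vec m)\}$. Order: $\vec m\trianglelefteq\vec n$ iff $\vec m_{ij}\leq\vec n_{ij}$ for all $i,j$. "Decreasing" is meant in the non-strict sense for $\trianglelefteq$. *)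

theory Defs
  imports "Jordan_Normal_Form.Matrix" "HOL-Library.Lattice_Constructions"
begin

text \<open>
  The type \<open>'a top\<close> adjoins a greatest element \<open>top.Top\<close>, playing the role of \<open>+\<infinity>\<close>, to the scalars
  \<open>top.Value x\<close>; the constructor names are qualified because \<open>Lattice_Constructions\<close> reuses them for
  another datatype. An \<open>n \<times> n\<close> difference-bound matrix is an element of \<open>carrier_mat n n\<close>, and the
  order on matrices of equal dimensions is the entrywise one of \<open>Jordan_Normal_Form.Matrix\<close>.

  Indices start at 0, so that the first variable, which \<open>V0_domain\<close> fixes to zero, has index 0.
\<close>

type_synonym 'a dbm = "'a top mat"

definition V_domain :: "'a :: {minus, preorder} dbm \<Rightarrow> 'a vec set" where
  "V_domain m = {x \<in> carrier_vec (dim_row m).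
     \<forall>i < dim_row m. \<forall>j < dim_row m. top.Value (x $ j - x $ i) \<le> m $$ (i, j)}"

definition V0_domain :: "'a :: {zero, minus, preorder} dbm \<Rightarrow> 'a vec set" where
  "V0_domain m = {x \<in> carrier_vec (dim_row m - 1). vCons 0 x \<in> V_domain m}"

definition dbm_narrow :: "'a dbm \<Rightarrow> 'a dbm \<Rightarrow> 'a dbm" (infixl \<open>\<triangle>\<close> 70) where
  "m \<triangle> n = mat (dim_row m) (dim_col m)
     (\<lambda>(i, j). if m $$ (i, j) = top.Top then n $$ (i, j) else m $$ (i, j))"

definition ultimately_stationary :: "(nat \<Rightarrow> 'a) \<Rightarrow> bool" where
  "ultimately_stationary x \<longleftrightarrow> (\<exists>N. \<forall>k \<ge> N. x k = x N)"

end

theory Submission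
  imports Defs
begin

text \<open>Narrowing overwrites only the entries of \<open>m\<close> equal to
  \<open>top.Top\<close>, the greatest element, so it can only tighten constraints; this gives the
  upper inclusion and the descent of the chain. Each entry of \<open>m \<triangle> n\<close> is an
  entry of \<open>m\<close> or of \<open>n\<close>, so a point meeting both systems of constraints
  meets the narrowed one; when the domain of \<open>n\<close> lies inside that of \<open>m\<close>,
  every point of the former is such a point (\<open>V0_domain_narrow\<close>). Along the chain a
  finite entry is never overwritten again, so each of the finitely many positions changes at most
  once and the whole matrix eventually freezes (\<open>narrow_chain\<close>).\<close>

lemma narrow_carrier_mat [simp]: "m \<in> carrier_mat r c \<Longrightarrow> m \<triangle> n \<in> carrier_mat r c"
  by (auto simp: dbm_narrow_def)

lemma narrow_index:
  assumes "m \<in> carrier_mat r c" "i < r" "j < c"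
  shows "(m \<triangle> n) $$ (i, j) = (if m $$ (i, j) = top.Top then n $$ (i, j) else m $$ (i, j))"
  using assms by (auto simp: dbm_narrow_def)

lemma narrow_le:
  fixes m n :: "'a :: preorder dbm"
  assumes "m \<in> carrier_mat r c"
  shows "m \<triangle> n \<le> m"
  using assms by (auto simp: less_eq_mat_def dbm_narrow_def)

text \<open>The conjunct \<open>vCons 0 x \<in> carrier_vec d\<close> matters for
  \<open>d = 0\<close>: there \<open>d - 1\<close> truncates to 0 while \<open>vCons 0 x\<close> has
  dimension 1, so both sides are false.\<close>

lemma V0_domain_iff:
  assumes "m \<in> carrier_mat d d"
  shows "x \<in> V0_domain m \<longleftrightarrow> x \<in> carrier_vec (d - 1) \<and> vCons 0 x \<in> carrier_vec d \<and>
    (\<forall>i<d. \<forall>j<d. top.Value (vCons 0 x $ j - vCons 0 x $ i) \<le> m $$ (i, j))"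
  using assms by (auto simp: V0_domain_def V_domain_def)

lemma V0_domain_narrow:
  fixes m n :: "'a :: {zero, minus, preorder} dbm"
  assumes m: "m \<in> carrier_mat d d" and n: "n \<in> carrier_mat d d"
    and sub: "V0_domain n \<subseteq> V0_domain m"
  shows "V0_domain n \<subseteq> V0_domain (m \<triangle> n)" "V0_domain (m \<triangle> n) \<subseteq> V0_domain m"
proof -
  note mn = narrow_carrier_mat[OF m, of n]
  show "V0_domain n \<subseteq> V0_domain (m \<triangle> n)"
  proof
    fix x assume x: "x \<in> V0_domain n"
    then have "x \<in> V0_domain m" using sub by blast
    with x show "x \<in> V0_domain (m \<triangle> n)"
      unfolding V0_domain_iff[OF m] V0_domain_iff[OF n] V0_domain_iff[OF mn]
      by (auto simp: narrow_index[OF m])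
  qed
  show "V0_domain (m \<triangle> n) \<subseteq> V0_domain m"
  proof
    fix x assume x: "x \<in> V0_domain (m \<triangle> n)"
    \<comment> \<open>Where \<open>m\<close> has \<open>top.Top\<close> the bound is vacuous;
      elsewhere the two entries coincide.\<close>
    have le: "a \<le> m $$ (i, j)" if "a \<le> (m \<triangle> n) $$ (i, j)" "i < d" "j < d" for a i j
      using that by (cases "m $$ (i, j) = top.Top") (auto simp: narrow_index[OF m])
    show "x \<in> V0_domain m"
      using x le unfolding V0_domain_iff[OF m] V0_domain_iff[OF mn] by blast
  qed
qed

text \<open>The scalars may admit infinite descent, so the argument counts changes instead of
  appealing to well-foundedness: a position can only pass once from \<open>top.Top\<close> to a
  finite value, hence at most \<open>r * c\<close> steps alter the matrix.\<close>

lemma narrow_chain: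
  fixes n x :: "nat \<Rightarrow> 'a :: order dbm"
  assumes x0: "x 0 \<in> carrier_mat r c" and step: "\<And>i. x (Suc i) = x i \<triangle> n i"
  shows "decseq x" "ultimately_stationary x"
proof -
  have car: "x k \<in> carrier_mat r c" for k
    by (induction k) (use x0 in \<open>simp_all add: step\<close>)
  show "decseq x"
    unfolding decseq_Suc_iff using narrow_le[OF car] by (simp add: step)
  have fixed: "x k $$ (i, j) = x N $$ (i, j)"
    if "x N $$ (i, j) \<noteq> top.Top" "i < r" "j < c" "k \<ge> N" for i j k N
    using \<open>k \<ge> N\<close>
    by (induction k rule: dec_induct) (use that in \<open>simp_all add: step narrow_index[OF car]\<close>)
  \<comment> \<open>If the entry is finite at some index, that index serves as \<open>N\<close>;
    otherwise it is \<open>top.Top\<close> forever and any \<open>N\<close> works.\<close>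
  have "\<exists>N. \<forall>k\<ge>N. x k $$ (i, j) = x N $$ (i, j)" if "i < r" "j < c" for i j
    using fixed[OF _ that] by metis
  then have "\<forall>p \<in> {..<r} \<times> {..<c}. \<exists>N. \<forall>k\<ge>N. x k $$ p = x N $$ p"
    by auto
  then obtain N where N: "\<And>p k. p \<in> {..<r} \<times> {..<c} \<Longrightarrow> k \<ge> N p \<Longrightarrow> x k $$ p = x (N p) $$ p"
    by metis
  \<comment> \<open>A common bound for all positions; inserting 0 keeps the set nonempty when the
    matrix has no entries.\<close>
  define M where "M = Max (insert 0 (N ` ({..<r} \<times> {..<c})))"
  have M: "N p \<le> M" if "p \<in> {..<r} \<times> {..<c}" for p
    unfolding M_def by (rule Max_ge) (use that in auto)
  have "x k = x M" if "k \<ge> M" for k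
  proof (rule eq_matI)
    fix i j assume "i < dim_row (x M)" "j < dim_col (x M)"
    then have p: "(i, j) \<in> {..<r} \<times> {..<c}"
      using car[of M] by auto
    \<comment> \<open>Both \<open>k\<close> and \<open>M\<close> lie beyond \<open>N (i, j)\<close>,
      so both entries equal the one at that index.\<close>
    show "x k $$ (i, j) = x M $$ (i, j)"
      using N[OF p M[OF p]] N[OF p order_trans[OF M[OF p] that]] by simp
  qed (use car[of k] car[of M] in auto)
  then show "ultimately_stationary x"
    unfolding ultimately_stationary_def by blast
qed

theorem theorem9:
  fixes d :: nat
  assumes "d \<ge> 1"
  shows "(\<forall>m \<in> carrier_mat d d. \<forall>n \<in> carrier_mat d d.
             V0_domain (n :: int dbm) \<subseteq> V0_domain m \<longrightarrow>
             V0_domain n \<subseteq> V0_domain (m \<triangle> n) \<and> V0_domain (m \<triangle> n) \<subseteq> V0_domain m) \<and>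
         (\<forall>m \<in> carrier_mat d d. \<forall>n x :: nat \<Rightarrow> int dbm.
             (\<forall>i. n i \<in> carrier_mat d d) \<and> decseq n \<and>
             x 0 = m \<and> (\<forall>i. x (Suc i) = x i \<triangle> n i) \<longrightarrow>
             decseq x \<and> ultimately_stationary x) \<and>
         (\<forall>m \<in> carrier_mat d d. \<forall>n \<in> carrier_mat d d.
             V0_domain (n :: rat dbm) \<subseteq> V0_domain m \<longrightarrow>
             V0_domain n \<subseteq> V0_domain (m \<triangle> n) \<and> V0_domain (m \<triangle> n) \<subseteq> V0_domain m) \<and>
         (\<forall>m \<in> carrier_mat d d. \<forall>n x :: nat \<Rightarrow> rat dbm.
             (\<forall>i. n i \<in> carrier_mat d d) \<and> decseq n \<and>
             x 0 = m \<and> (\<forall>i. x (Suc i) = x i \<triangle> n i) \<longrightarrow>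
             decseq x \<and> ultimately_stationary x) \<and>
         (\<forall>m \<in> carrier_mat d d. \<forall>n \<in> carrier_mat d d.
             V0_domain (n :: real dbm) \<subseteq> V0_domain m \<longrightarrow>
             V0_domain n \<subseteq> V0_domain (m \<triangle> n) \<and> V0_domain (m \<triangle> n) \<subseteq> V0_domain m) \<and>
         (\<forall>m \<in> carrier_mat d d. \<forall>n x :: nat \<Rightarrow> real dbm.
             (\<forall>i. n i \<in> carrier_mat d d) \<and> decseq n \<and>
             x 0 = m \<and> (\<forall>i. x (Suc i) = x i \<triangle> n i) \<longrightarrow>
             decseq x \<and> ultimately_stationary x)"
  \<comment> \<open>Both lemmas are polymorphic in the scalars, so each of the six conjuncts is an
    instance at \<open>int\<close>, \<open>rat\<close> or \<open>real\<close>.\<close>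
  by (intro conjI ballI allI impI; (elim conjE)?; (rule V0_domain_narrow narrow_chain)?; simp)

end
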